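(* Let $C$ be a curve in a Myller configuration $M(C,\bar\xi,\pi)$ with Frenet-type frame $R_F=\{P(s);\bar\xi_1,\bar\xi_2,\bar\xi_3\}$ and (nowhere) non-zero curvatures $K_1,K_2$. Then $C$ is a $\bar\xi_1$-helix (equivalently, a $\bar\xi_3$-helix) if and only if $$\bar\xi_3'''-\left[\frac{(K_1K_2)'}{K_1K_2}+\frac{K_2'}{K_2}\right]\bar\xi_3''+\left\{K_1K_2\left[\frac1{K_1}\left(\frac1{K_2}\right)'\right]'+K_1^2+K_2^2\right\}\bar\xi_3'=0.$$
   Context: All data are smooth. Let $C$ be a curve in Euclidean space $E^3$ with arclength parameter $s\in I$ ($I$ an interval) and position vector $\bar r(s)$, let $\bar\xi(s)$ be a unit vector field along $C$ (a versor field $(C,\bar\xi)$), and let $\pi(s)$ be a plane field along $C$ with $\bar\xi(s)\in\pi(s)$. The pair $((C,\bar\xi),(C,\pi))$ is called a Myller configuration $M=M(C,\bar\xi,\pi)$. Put $\bar\xi_1=\bar\xi$, $K_1=\|d\bar\xi/ds\|>0$ (curvature), define $\bar\xi_2$ by $\bar\xi_1'=K_1\bar\xi_2$, and $\bar\xi_3=\bar\xi_1\times\bar\xi_2$. Then $R_F=\{P(s);\bar\xi_1,\bar\xi_2,\bar\xi_3\}$ is a positively oriented orthonormal frame, the Frenet-type frame, and $$\bar\xi_1'=K_1\bar\xi_2,\quad \bar\xi_2'=-K_1\bar\xi_1+K_2\bar\xi_3,\quad \bar\xi_3'=-K_2\bar\xi_2,$$ which defines the torsion $K_2$. A prime denotes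 $d/ds$. The curve $C$ is called a $\bar\xi_i$-helix ($i=1,2,3$) if $\bar\xi_i$ makes a constant angle with a constant direction (a fixed unit vector). *)

theory Defs
  imports "HOL-Analysis.Analysis"
begin

text \<open>
  The parameter interval may be open, closed or half-open; derivatives are taken relative to it, so
  they are one-sided at an end point that belongs to the interval.
\<close>

definition deriv_along :: "real set \<Rightarrow> (real \<Rightarrow> 'a::real_normed_vector) \<Rightarrow> real \<Rightarrow> 'a"
  where "deriv_along I f = (\<lambda>s. vector_derivative f (at s within I))"

definition smooth_along :: "real set \<Rightarrow> (real \<Rightarrow> 'a::real_normed_vector) \<Rightarrow> bool"
  where "smooth_along I f \<longleftrightarrow>
    (\<forall>n. \<forall>s\<in>I. (deriv_along I ^^ n) f differentiable (at s within I))"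

definition arclength_curve :: "real set \<Rightarrow> (real \<Rightarrow> real^3) \<Rightarrow> bool"
  where "arclength_curve I r \<longleftrightarrow> smooth_along I r \<and> (\<forall>s\<in>I. norm (deriv_along I r s) = 1)"

definition versor_field :: "real set \<Rightarrow> (real \<Rightarrow> real^3) \<Rightarrow> bool"
  where "versor_field I \<xi> \<longleftrightarrow> smooth_along I \<xi> \<and> (\<forall>s\<in>I. norm (\<xi> s) = 1)"

text \<open>
  A plane of the field is represented by its direction, a two-dimensional space of vectors applied
  at the point \<open>r s\<close> of the curve; smoothness means that smooth spanning fields exist locally.
\<close>

definition plane_field :: "real set \<Rightarrow> (real \<Rightarrow> (real^3) set) \<Rightarrow> bool"
  where "plane_field I \<pi> \<longleftrightarrow>
    (\<forall>s\<in>I. \<exists>e>0. \<exists>u v. smooth_along (I \<inter> ball s e) u \<and> smooth_along (I \<inter> ball s e) v \<and>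
      (\<forall>t \<in> I \<inter> ball s e. \<pi> t = span {u t, v t} \<and> dim (\<pi> t) = 2))"

definition myller_configuration ::
    "real set \<Rightarrow> (real \<Rightarrow> real^3) \<Rightarrow> (real \<Rightarrow> real^3) \<Rightarrow> (real \<Rightarrow> (real^3) set) \<Rightarrow> bool"
  where "myller_configuration I r \<xi> \<pi> \<longleftrightarrow>
    is_interval I \<and> interior I \<noteq> {} \<and>
    arclength_curve I r \<and> versor_field I \<xi> \<and> plane_field I \<pi> \<and> (\<forall>s\<in>I. \<xi> s \<in> \<pi> s)"

definition curvature1 :: "real set \<Rightarrow> (real \<Rightarrow> real^3) \<Rightarrow> real \<Rightarrow> real"
  where "curvature1 I \<xi> = (\<lambda>s. norm (deriv_along I \<xi> s))"

definition frame2 :: "real set \<Rightarrow> (real \<Rightarrow> real^3) \<Rightarrow> real \<Rightarrow> real^3"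
  where "frame2 I \<xi> = (\<lambda>s. (1 / curvature1 I \<xi> s) *\<^sub>R deriv_along I \<xi> s)"

definition frame3 :: "real set \<Rightarrow> (real \<Rightarrow> real^3) \<Rightarrow> real \<Rightarrow> real^3"
  where "frame3 I \<xi> = (\<lambda>s. cross3 (\<xi> s) (frame2 I \<xi> s))"

text \<open>
  The torsion is the coefficient of the third frame vector in the derivative of the second one;
  \<open>frenet_type_equations\<close> below shows that it satisfies all the moving equations of the frame.
\<close>

definition curvature2 :: "real set \<Rightarrow> (real \<Rightarrow> real^3) \<Rightarrow> real \<Rightarrow> real"
  where "curvature2 I \<xi> = (\<lambda>s. deriv_along I (frame2 I \<xi>) s \<bullet> frame3 I \<xi> s)"

definition vec_angle :: "real^3 \<Rightarrow> real^3 \<Rightarrow> real"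
  where "vec_angle u v = arccos (u \<bullet> v / (norm u * norm v))"

text \<open>The curve is a \<open>\<xi>\<^sub>i\<close>-helix if the following holds for the frame vector field \<open>w = \<xi>\<^sub>i\<close>.\<close>

definition helix :: "real set \<Rightarrow> (real \<Rightarrow> real^3) \<Rightarrow> bool"
  where "helix I w \<longleftrightarrow> (\<exists>d. norm d = 1 \<and> (\<lambda>s. vec_angle (w s) d) constant_on I)"

lemma orthonormal_expansion:
  fixes a b v :: "real^3"
  assumes "a \<bullet> a = 1" "b \<bullet> b = 1" "a \<bullet> b = 0"
  shows "v = (v \<bullet> a) *\<^sub>R a + (v \<bullet> b) *\<^sub>R b + (v \<bullet> cross3 a b) *\<^sub>R cross3 a b"
proof -
  let ?c = "cross3 a b"
  have c: "?c \<bullet> ?c = 1"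
    using norm_cross_dot[of a b] assms by (simp add: norm_eq_sqrt_inner)
  have o: "a \<bullet> ?c = 0" "b \<bullet> ?c = 0" "?c \<bullet> a = 0" "?c \<bullet> b = 0" "b \<bullet> a = 0"
    using assms by (simp_all add: dot_cross_self inner_commute)
  define w where "w = v - ((v \<bullet> a) *\<^sub>R a + (v \<bullet> b) *\<^sub>R b + (v \<bullet> ?c) *\<^sub>R ?c)"
  have wa: "w \<bullet> a = 0" and wb: "w \<bullet> b = 0" and wc: "w \<bullet> ?c = 0"
    using assms o c by (simp_all add: w_def inner_diff_left inner_add_left)
  have "cross3 w ?c = 0"
    using wa wb by (simp add: Lagrange)
  moreover have "?c \<noteq> 0" using c by auto
  ultimately have "w = 0"
    using wc norm_and_cross_eq_0[of w ?c] by simp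
  then show ?thesis by (simp add: w_def)
qed

lemma nontrivial_within:
  fixes I :: "real set"
  assumes "is_interval I" "interior I \<noteq> {}" "s \<in> I"
  shows "at s within I \<noteq> bot"
proof -
  have "I \<noteq> {x}" for x using assms(2) by auto
  then have "s islimpt I"
    using connected_imp_perfect[of I s] assms(1,3) is_interval_connected by blast
  then show ?thesis by (simp add: trivial_limit_within)
qed

theorem frenet_type_equations:
  assumes M: "myller_configuration I r \<xi> \<pi>"
    and K1: "\<forall>s\<in>I. curvature1 I \<xi> s > 0"
    and s: "s \<in> I"
  shows "deriv_along I \<xi> s = curvature1 I \<xi> s *\<^sub>R frame2 I \<xi> s"
    and "deriv_along I (frame2 I \<xi>) s =
           - curvature1 I \<xi> s *\<^sub>R \<xi> s + curvature2 I \<xi> s *\<^sub>R frame3 I \<xi> s"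
    and "deriv_along I (frame3 I \<xi>) s = - curvature2 I \<xi> s *\<^sub>R frame2 I \<xi> s"
    and "norm (\<xi> s) = 1" "norm (frame2 I \<xi> s) = 1" "norm (frame3 I \<xi> s) = 1"
    and "\<xi> s \<bullet> frame2 I \<xi> s = 0" "\<xi> s \<bullet> frame3 I \<xi> s = 0" "frame2 I \<xi> s \<bullet> frame3 I \<xi> s = 0"
proof -
  let ?D = "deriv_along I" and ?k1 = "curvature1 I \<xi>" and ?k2 = "curvature2 I \<xi>"
  let ?e2 = "frame2 I \<xi>" and ?e3 = "frame3 I \<xi>"
  have int: "is_interval I" "interior I \<noteq> {}"
    and sm: "smooth_along I \<xi>" and unit: "\<And>t. t \<in> I \<Longrightarrow> norm (\<xi> t) = 1"
    using M by (auto simp: myller_configuration_def versor_field_def)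
  have d0: "\<xi> differentiable (at t within I)" if "t \<in> I" for t
    using sm that unfolding smooth_along_def by (metis funpow_0)
  have d1: "?D \<xi> differentiable (at t within I)" if "t \<in> I" for t
    using sm[unfolded smooth_along_def, rule_format, of t 1] that by simp
  have eq1: "?D \<xi> t = ?k1 t *\<^sub>R ?e2 t" if "t \<in> I" for t
    using K1 that by (force simp: frame2_def)
  have u2: "norm (?e2 t) = 1" if "t \<in> I" for t
    using K1 that by (force simp: frame2_def curvature1_def)
  have D0: "(\<xi> has_vector_derivative ?D \<xi> t) (at t within I)" if "t \<in> I" for t
    using d0[OF that] by (simp add: vector_derivative_works deriv_along_def)
  have D2: "(?e2 has_vector_derivative ?D ?e2 t) (at t within I)" if t: "t \<in> I" for t
  proof -
    have "?D \<xi> t \<noteq> 0" using K1 t by (force simp: curvature1_def)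
    then have "(\<lambda>y. inverse (norm (?D \<xi> y))) differentiable (at t within I)"
      using d1[OF t] differentiable_compose[OF differentiable_norm_at]
      by (intro differentiable_inverse) auto
    then have "?e2 differentiable (at t within I)"
      unfolding frame2_def curvature1_def
      using d1[OF t] by (auto simp: divide_inverse intro!: differentiable_scaleR)
    then show ?thesis by (simp add: vector_derivative_works deriv_along_def)
  qed
  have const: "d = 0"
    if "(f has_vector_derivative d) (at t within I)" "\<And>x. x \<in> I \<Longrightarrow> f x = c" "t \<in> I"
    for f :: "real \<Rightarrow> real" and c d t
  proof -
    have "((\<lambda>_. c) has_vector_derivative d) (at t within I)"
      using has_vector_derivative_transform[OF that(3) _ that(1), of "\<lambda>_. c"] that(2) by simp
    then show ?thesis
      using vector_derivative_unique_within[OF nontrivial_within[OF int that(3)]]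
        has_vector_derivative_const by blast
  qed
  have inner_D: "((\<lambda>x. f x \<bullet> g x) has_vector_derivative f t \<bullet> g' + f' \<bullet> g t) (at t within I)"
    if "(f has_vector_derivative f') (at t within I)" "(g has_vector_derivative g') (at t within I)"
    for f g :: "real \<Rightarrow> real^3" and f' g' t
    using has_derivative_inner[OF that[unfolded has_vector_derivative_def]]
    by (simp add: has_vector_derivative_def algebra_simps)
  have o1: "\<xi> t \<bullet> ?D \<xi> t = 0" if t: "t \<in> I" for t
    using const[OF inner_D[OF D0[OF t] D0[OF t]], of 1] unit t
    by (simp add: inner_commute norm_eq_1)
  have o12: "\<xi> t \<bullet> ?e2 t = 0" if t: "t \<in> I" for t
    using o1[OF t] by (simp add: frame2_def)
  have o2: "?e2 s \<bullet> ?D ?e2 s = 0"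
    using const[OF inner_D[OF D2[OF s] D2[OF s]], of 1] u2 s
    by (simp add: inner_commute norm_eq_1)
  have "\<xi> s \<bullet> ?D ?e2 s + ?D \<xi> s \<bullet> ?e2 s = 0"
    using const[OF inner_D[OF D0[OF s] D2[OF s]], of 0] o12 s by simp
  then have o3: "?D ?e2 s \<bullet> \<xi> s = - ?k1 s"
    using u2[OF s] by (simp add: eq1[OF s] norm_eq_1 inner_commute)
  show eq2: "?D ?e2 s = - ?k1 s *\<^sub>R \<xi> s + ?k2 s *\<^sub>R ?e3 s"
    using orthonormal_expansion[of "\<xi> s" "?e2 s" "?D ?e2 s"] unit[OF s] u2[OF s] o12[OF s] o2 o3
    by (simp add: norm_eq_1 inner_commute frame3_def curvature2_def)
  have "bounded_bilinear cross3"
    using bilinear_cross bilinear_conv_bounded_bilinear by blast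
  from bounded_bilinear.has_vector_derivative[OF this D0[OF s] D2[OF s]]
  have "(?e3 has_vector_derivative cross3 (\<xi> s) (?D ?e2 s) + cross3 (?D \<xi> s) (?e2 s))
      (at s within I)"
    by (simp add: frame3_def)
  moreover have "cross3 (\<xi> s) (?D ?e2 s) + cross3 (?D \<xi> s) (?e2 s) = - ?k2 s *\<^sub>R ?e2 s"
    using unit[OF s] o12[OF s]
    by (simp add: eq2 eq1[OF s] cross_add_right Cross3.right_diff_distrib cross_mult_right
        cross_mult_left frame3_def Lagrange norm_eq_1)
  ultimately show "?D ?e3 s = - ?k2 s *\<^sub>R ?e2 s"
    using vector_derivative_within[OF nontrivial_within[OF int s]] by (simp add: deriv_along_def)
  show "norm (?e3 s) = 1"
    using norm_cross_dot[of "\<xi> s" "?e2 s"] unit[OF s] u2[OF s] o12[OF s]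
    by (simp add: frame3_def power2_eq_1_iff) (smt (verit) norm_ge_zero)
  show "?D \<xi> s = ?k1 s *\<^sub>R ?e2 s" "norm (\<xi> s) = 1" "norm (?e2 s) = 1" "\<xi> s \<bullet> ?e2 s = 0"
    using eq1 unit u2 o12 s by auto
  show "\<xi> s \<bullet> ?e3 s = 0" "?e2 s \<bullet> ?e3 s = 0"
    by (simp_all add: frame3_def dot_cross_self)
qed

end

theory Submission
  imports Defs
begin

text \<open>
  Write \<open>e\<^sub>1, e\<^sub>2, e\<^sub>3\<close> for the frame and \<open>k\<^sub>1, k\<^sub>2\<close> for the curvatures. The derivatives of \<open>e\<^sub>1\<close> and \<open>e\<^sub>3\<close>
  are both nowhere vanishing multiples of \<open>e\<^sub>2\<close>, so each of them keeps a constant inner product with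
  a fixed direction \<open>d\<close> exactly when \<open>d\<close> is orthogonal to \<open>e\<^sub>2\<close> all along the curve
  (\<open>helix_iff_fixed_normal\<close>). Hence the two helix notions coincide.

  Such a direction exists exactly when \<open>k\<^sub>1 / k\<^sub>2\<close> is constant, as in Lancret's theorem on classical
  helices. If \<open>d\<close> exists, its components \<open>a\<close> and \<open>b\<close> along \<open>e\<^sub>1\<close> and \<open>e\<^sub>3\<close> are constants, not both
  zero, with \<open>k\<^sub>2 b = k\<^sub>1 a\<close>; this and its derivative force \<open>k\<^sub>2 k\<^sub>1' = k\<^sub>1 k\<^sub>2'\<close>. Conversely, if \<open>k\<^sub>1 = c k\<^sub>2\<close>, then
  \<open>e\<^sub>1 + c e\<^sub>3\<close> is a constant vector orthogonal to \<open>e\<^sub>2\<close>.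

  The differential equation is the same criterion in another form. When the derivatives of \<open>e\<^sub>3\<close> are
  expanded in the frame, the coefficients of the equation are just those that annihilate the components along
  \<open>e\<^sub>1\<close> and \<open>e\<^sub>2\<close> for every curve; what is left is
  \<open>(k\<^sub>2 / k\<^sub>1) (k\<^sub>2 k\<^sub>1' - k\<^sub>1 k\<^sub>2') e\<^sub>3\<close> (\<open>binormal_operator_eq\<close>).

  These computations differentiate \<open>k\<^sub>1\<close> once and \<open>k\<^sub>2\<close> twice. Both arise from \<open>\<xi>\<close> by
  differentiation, a norm, a quotient and products, so their smoothness rests on closure properties of smooth functions, which
  are proved by induction on the order of differentiability.
\<close>

section \<open>Calculus relative to a parameter interval\<close>

locale parameter_interval =
  fixes I :: "real set"
  assumes interval: "is_interval I" and interior_nonempty: "interior I \<noteq> {}"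
begin

abbreviation D :: "(real \<Rightarrow> 'a::real_normed_vector) \<Rightarrow> real \<Rightarrow> 'a"
  where "D \<equiv> deriv_along I"

lemma deriv_along_eq:
  assumes "s \<in> I" "(f has_vector_derivative d) (at s within I)"
  shows "D f s = d"
  using vector_derivative_within[OF nontrivial_within[OF interval interior_nonempty assms(1)] assms(2)]
  by (simp add: deriv_along_def)

lemma has_deriv_along:
  assumes "f differentiable (at s within I)"
  shows "(f has_vector_derivative D f s) (at s within I)"
  using assms by (simp add: vector_derivative_works deriv_along_def)

lemma differentiable_iff_has_vector_derivative:
  "f differentiable (at s within I) \<longleftrightarrow> (\<exists>d. (f has_vector_derivative d) (at s within I))"
  using has_deriv_along differentiableI_vector by blast

lemma has_vector_derivative_cong_on:
  assumes "s \<in> I" "\<And>t. t \<in> I \<Longrightarrow> f t = g t"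
  shows "(f has_vector_derivative d) (at s within I) \<longleftrightarrow> (g has_vector_derivative d) (at s within I)"
  using assms by (metis has_vector_derivative_transform)

lemma deriv_along_cong:
  assumes "s \<in> I" "\<And>t. t \<in> I \<Longrightarrow> f t = g t"
  shows "D f s = D g s"
  using has_vector_derivative_cong_on[OF assms] by (simp add: deriv_along_def vector_derivative_def)

lemma zero_deriv_imp_constant_on:
  assumes "\<And>s. s \<in> I \<Longrightarrow> (f has_vector_derivative 0) (at s within I)"
  shows "f constant_on I"
proof -
  have "convex I" using interval by (simp add: is_interval_convex)
  then obtain c where "\<And>x. x \<in> I \<Longrightarrow> f x = c"
    using has_vector_derivative_zero_constant[of I f] assms by blast
  then show ?thesis by (auto simp: constant_on_def)
qed

lemma constant_on_imp_zero_deriv: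
  assumes "f constant_on I" "s \<in> I"
  shows "(f has_vector_derivative 0) (at s within I)"
proof -
  obtain c where "\<And>x. x \<in> I \<Longrightarrow> f x = c" using assms(1) by (auto simp: constant_on_def)
  then show ?thesis
    using has_vector_derivative_cong_on[OF assms(2), of f "\<lambda>_. c"] by simp
qed

text \<open>
  Smoothness is stratified by order, and the recursion takes the derivative first, so that a function
  is differentiable to order \<open>n + 1\<close> as soon as its derivative is an expression in functions of
  order \<open>n\<close>. Closure properties then follow by induction from the differentiation rules.
\<close>

primrec differentiable_order :: "nat \<Rightarrow> (real \<Rightarrow> 'a::real_normed_vector) \<Rightarrow> bool"
  where
    "differentiable_order 0 f \<longleftrightarrow> True"
  | "differentiable_order (Suc n) f \<longleftrightarrow>
      (\<forall>s\<in>I. f differentiable (at s within I)) \<and> differentiable_order n (D f)"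

lemma differentiable_order_iff:
  "differentiable_order n f \<longleftrightarrow> (\<forall>m<n. \<forall>s\<in>I. (D ^^ m) f differentiable (at s within I))"
proof (induction n arbitrary: f)
  case (Suc n)
  show ?case
    by (simp add: Suc All_less_Suc2 funpow_swap1)
qed simp

lemma smooth_along_iff_order: "smooth_along I f \<longleftrightarrow> (\<forall>n. differentiable_order n f)"
  unfolding smooth_along_def differentiable_order_iff by blast

lemma differentiable_order_SucD: "differentiable_order (Suc n) f \<Longrightarrow> differentiable_order n f"
  by (auto simp: differentiable_order_iff)

lemma differentiable_order_cong:
  assumes "\<And>s. s \<in> I \<Longrightarrow> f s = g s"
  shows "differentiable_order n f \<longleftrightarrow> differentiable_order n g"
  using assms
proof (induction n arbitrary: f g)
  case (Suc n)
  have "differentiable_order n (D f) \<longleftrightarrow> differentiable_order n (D g)"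
    using Suc.prems by (intro Suc.IH deriv_along_cong) auto
  moreover have "f differentiable (at s within I) \<longleftrightarrow> g differentiable (at s within I)"
    if "s \<in> I" for s
    using has_vector_derivative_cong_on[OF that Suc.prems]
    by (simp add: differentiable_iff_has_vector_derivative)
  ultimately show ?case by simp
qed simp

text \<open>
  The induction step of the closure properties below: \<open>g\<close> is the formula that the differentiation
  rule gives, and it need only agree with the derivative on the interval.
\<close>

lemma differentiable_order_SucI:
  assumes "\<And>s. s \<in> I \<Longrightarrow> (f has_vector_derivative g s) (at s within I)"
    and "differentiable_order n g"
  shows "differentiable_order (Suc n) f"
proof -
  have "differentiable_order n (D f) \<longleftrightarrow> differentiable_order n g"
    by (rule differentiable_order_cong) (use assms(1) deriv_along_eq in blast)
  then show ?thesis using assms by (auto intro: differentiableI_vector)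
qed

lemma differentiable_order_add:
  assumes "differentiable_order n f" "differentiable_order n g"
  shows "differentiable_order n (\<lambda>s. f s + g s)"
  using assms
proof (induction n arbitrary: f g)
  case (Suc n)
  show ?case
    by (rule differentiable_order_SucI[where g = "\<lambda>s. D f s + D g s"])
      (use Suc in \<open>auto intro!: has_vector_derivative_add has_deriv_along\<close>)
qed simp

lemma differentiable_order_bilinear:
  assumes "bounded_bilinear h" "differentiable_order n f" "differentiable_order n g"
  shows "differentiable_order n (\<lambda>s. h (f s) (g s))"
  using assms(2,3)
proof (induction n arbitrary: f g)
  case (Suc n)
  note orders = Suc.prems[THEN differentiable_order_SucD]
  show ?case
  proof (rule differentiable_order_SucI)
    show "((\<lambda>s. h (f s) (g s)) has_vector_derivative h (f s) (D g s) + h (D f s) (g s))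
        (at s within I)" if "s \<in> I" for s
      using Suc.prems that
      by (intro bounded_bilinear.has_vector_derivative[OF assms(1)] has_deriv_along) auto
    show "differentiable_order n (\<lambda>s. h (f s) (D g s) + h (D f s) (g s))"
      using Suc.prems orders by (intro differentiable_order_add Suc.IH) auto
  qed
qed simp

lemma differentiable_order_minus:
  assumes "differentiable_order n f"
  shows "differentiable_order n (\<lambda>s. - f s)"
  using assms
proof (induction n arbitrary: f)
  case (Suc n)
  show ?case
    by (rule differentiable_order_SucI[where g = "\<lambda>s. - D f s"])
      (use Suc in \<open>auto intro!: has_vector_derivative_minus has_deriv_along\<close>)
qed simp

text \<open>
  Here and for the norm, the derivative involves the function under consideration itself, but only
  to the order already covered by the induction hypothesis.
\<close>

lemma differentiable_order_inverse:
  fixes f :: "real \<Rightarrow> real"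
  assumes "\<And>s. s \<in> I \<Longrightarrow> f s \<noteq> 0" "differentiable_order n f"
  shows "differentiable_order n (\<lambda>s. inverse (f s))"
  using assms(2)
proof (induction n)
  case (Suc n)
  let ?g = "\<lambda>s. inverse (f s)"
  note bil = differentiable_order_bilinear[OF bounded_bilinear_mult]
  have inv: "differentiable_order n ?g" using Suc differentiable_order_SucD by blast
  show ?case
  proof (rule differentiable_order_SucI)
    show "(?g has_vector_derivative - (D f s * (?g s * ?g s))) (at s within I)" if "s \<in> I" for s
      using DERIV_inverse_fun[of f "D f s" s I] has_deriv_along[of f s] Suc.prems assms(1)[OF that] that
      by (simp add: has_real_derivative_iff_has_vector_derivative mult.assoc mult.commute)
    show "differentiable_order n (\<lambda>s. - (D f s * (?g s * ?g s)))"
      using Suc.prems inv by (intro differentiable_order_minus bil) auto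
  qed
qed simp

lemma differentiable_order_norm:
  fixes f :: "real \<Rightarrow> 'a::real_inner"
  assumes "\<And>s. s \<in> I \<Longrightarrow> f s \<noteq> 0" "differentiable_order n f"
  shows "differentiable_order n (\<lambda>s. norm (f s))"
  using assms(2)
proof (induction n)
  case (Suc n)
  show ?case
  proof (rule differentiable_order_SucI)
    fix s assume s: "s \<in> I"
    have "(norm has_derivative (\<lambda>h. sgn (f s) \<bullet> h)) (at (f s))"
      using has_derivative_norm[OF assms(1)[OF s]] by (simp add: inner_commute)
    from vector_derivative_diff_chain_within[OF has_deriv_along[of f s]
        has_derivative_at_withinI[OF this]]
    show "((\<lambda>s. norm (f s)) has_vector_derivative (f s \<bullet> D f s) * inverse (norm (f s))) (at s within I)"
      using Suc.prems s by (simp add: o_def sgn_div_norm mult.commute)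
  next
    show "differentiable_order n (\<lambda>s. (f s \<bullet> D f s) * inverse (norm (f s)))"
      using Suc assms(1) differentiable_order_SucD[OF Suc.prems]
      by (intro differentiable_order_bilinear[OF bounded_bilinear_mult] differentiable_order_inverse
          differentiable_order_bilinear[OF bounded_bilinear_inner]) auto
  qed
qed simp

lemma smooth_along_differentiable:
  assumes "smooth_along I f" "s \<in> I"
  shows "f differentiable (at s within I)"
  using assms unfolding smooth_along_def by (metis funpow_0)

lemma smooth_along_deriv:
  assumes "smooth_along I f"
  shows "smooth_along I (D f)"
  using assms unfolding smooth_along_iff_order by (metis differentiable_order.simps(2))

lemma smooth_along_bilinear:
  assumes "bounded_bilinear h" "smooth_along I f" "smooth_along I g"
  shows "smooth_along I (\<lambda>s. h (f s) (g s))"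
  using assms by (simp add: smooth_along_iff_order differentiable_order_bilinear)

lemma smooth_along_inverse_norm:
  fixes f :: "real \<Rightarrow> 'a::real_inner"
  assumes "smooth_along I f" "\<And>s. s \<in> I \<Longrightarrow> f s \<noteq> 0"
  shows "smooth_along I (\<lambda>s. inverse (norm (f s)))"
  using assms by (simp add: smooth_along_iff_order differentiable_order_inverse differentiable_order_norm)

section \<open>Helices as fields with a fixed normal to their derivative\<close>

text \<open>Between unit vectors the angle is an injective function of the inner product.\<close>

lemma helix_iff_inner_constant:
  assumes "\<And>s. s \<in> I \<Longrightarrow> norm (w s) = 1"
  shows "helix I w \<longleftrightarrow> (\<exists>d. norm d = 1 \<and> (\<lambda>s. w s \<bullet> d) constant_on I)"
proof -
  have "(\<lambda>s. vec_angle (w s) d) constant_on I \<longleftrightarrow> (\<lambda>s. w s \<bullet> d) constant_on I" if d: "norm d = 1" for d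
  proof -
    have angle: "vec_angle (w s) d = arccos (w s \<bullet> d)" and bound: "\<bar>w s \<bullet> d\<bar> \<le> 1" if "s \<in> I" for s
      using assms[OF that] d Cauchy_Schwarz_ineq2[of "w s" d] by (simp_all add: vec_angle_def)
    have "vec_angle (w s) d = vec_angle (w t) d \<longleftrightarrow> w s \<bullet> d = w t \<bullet> d" if "s \<in> I" "t \<in> I" for s t
      using arccos_eq_iff bound that by (simp add: angle)
    then show ?thesis unfolding constant_on_def by metis
  qed
  then show ?thesis unfolding helix_def by blast
qed

text \<open>
  The derivative of the inner product with \<open>d\<close> is \<open>c (v \<bullet> d)\<close>. The right-hand side mentions only \<open>v\<close>,
  so two fields whose derivatives are parallel to the same \<open>v\<close> are helical together.
\<close>

lemma helix_iff_fixed_normal: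
  assumes unit: "\<And>s. s \<in> I \<Longrightarrow> norm (w s) = 1"
    and deriv: "\<And>s. s \<in> I \<Longrightarrow> (w has_vector_derivative c s *\<^sub>R v s) (at s within I)"
    and c: "\<And>s. s \<in> I \<Longrightarrow> c s \<noteq> 0"
  shows "helix I w \<longleftrightarrow> (\<exists>d. norm d = 1 \<and> (\<forall>s\<in>I. v s \<bullet> d = 0))"
proof -
  have d: "((\<lambda>s. w s \<bullet> d) has_vector_derivative c s * (v s \<bullet> d)) (at s within I)" if "s \<in> I" for s d
    using bounded_linear.has_vector_derivative[OF bounded_linear_inner_left deriv[OF that], of d] by simp
  have "(\<lambda>s. w s \<bullet> d) constant_on I \<longleftrightarrow> (\<forall>s\<in>I. v s \<bullet> d = 0)" for d
  proof
    assume const: "(\<lambda>s. w s \<bullet> d) constant_on I"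
    show "\<forall>s\<in>I. v s \<bullet> d = 0"
    proof
      fix s assume s: "s \<in> I"
      have "c s * (v s \<bullet> d) = 0"
        using deriv_along_eq[OF s d[OF s]] deriv_along_eq[OF s constant_on_imp_zero_deriv[OF const s]]
        by simp
      then show "v s \<bullet> d = 0" using c[OF s] by simp
    qed
  next
    assume "\<forall>s\<in>I. v s \<bullet> d = 0"
    then show "(\<lambda>s. w s \<bullet> d) constant_on I"
      using d[of _ d] by (intro zero_deriv_imp_constant_on) auto
  qed
  then show ?thesis using helix_iff_inner_constant[OF unit] by simp
qed

end

section \<open>Lancret's criterion and the differential equation of the binormal\<close>

text \<open>
  The moving equations are taken as hypotheses, so that the argument does not depend on how the frame
  and the curvatures were obtained.
\<close>

locale frenet_frame = parameter_interval +
  fixes e1 e2 e3 :: "real \<Rightarrow> real^3" and k1 k2 :: "real \<Rightarrow> real"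
  assumes smooth_k1: "smooth_along I k1" and smooth_k2: "smooth_along I k2"
    and k1_nonzero: "s \<in> I \<Longrightarrow> k1 s \<noteq> 0" and k2_nonzero: "s \<in> I \<Longrightarrow> k2 s \<noteq> 0"
    and unit1: "s \<in> I \<Longrightarrow> norm (e1 s) = 1" and unit2: "s \<in> I \<Longrightarrow> norm (e2 s) = 1"
    and orthogonal12: "s \<in> I \<Longrightarrow> e1 s \<bullet> e2 s = 0"
    and e3_eq: "s \<in> I \<Longrightarrow> e3 s = cross3 (e1 s) (e2 s)"
    and deriv_e1: "s \<in> I \<Longrightarrow> (e1 has_vector_derivative k1 s *\<^sub>R e2 s) (at s within I)"
    and deriv_e2: "s \<in> I \<Longrightarrow>
      (e2 has_vector_derivative - k1 s *\<^sub>R e1 s + k2 s *\<^sub>R e3 s) (at s within I)"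
    and deriv_e3: "s \<in> I \<Longrightarrow> (e3 has_vector_derivative - k2 s *\<^sub>R e2 s) (at s within I)"
begin

lemma deriv_k1: "s \<in> I \<Longrightarrow> (k1 has_vector_derivative D k1 s) (at s within I)"
  and deriv_k2: "s \<in> I \<Longrightarrow> (k2 has_vector_derivative D k2 s) (at s within I)"
  and deriv_D_k2: "s \<in> I \<Longrightarrow> (D k2 has_vector_derivative D (D k2) s) (at s within I)"
  by (auto intro!: has_deriv_along smooth_along_differentiable smooth_along_deriv smooth_k1 smooth_k2)

lemma unit3: "s \<in> I \<Longrightarrow> norm (e3 s) = 1"
  using norm_cross_dot[of "e1 s" "e2 s"]
  by (simp add: e3_eq unit1 unit2 orthogonal12 power2_eq_1_iff) (smt (verit) norm_ge_zero)

lemma helix_e1_iff: "helix I e1 \<longleftrightarrow> (\<exists>d. norm d = 1 \<and> (\<forall>s\<in>I. e2 s \<bullet> d = 0))"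
  by (rule helix_iff_fixed_normal[OF unit1 deriv_e1 k1_nonzero])

lemma helix_e3_iff: "helix I e3 \<longleftrightarrow> (\<exists>d. norm d = 1 \<and> (\<forall>s\<in>I. e2 s \<bullet> d = 0))"
  by (rule helix_iff_fixed_normal[OF unit3 deriv_e3]) (simp_all add: k2_nonzero)

text \<open>
  The constants \<open>a = e\<^sub>1 \<bullet> d\<close> and \<open>b = e\<^sub>3 \<bullet> d\<close> solve the homogeneous linear system with rows
  \<open>(- k\<^sub>1, k\<^sub>2)\<close> and \<open>(- k\<^sub>1', k\<^sub>2')\<close>. They do not both vanish, because \<open>d\<close> has no component along \<open>e\<^sub>2\<close>,
  so the determinant of the system does.
\<close>

lemma fixed_normal_imp_wronskian_zero:
  assumes d: "norm d = 1" "\<And>s. s \<in> I \<Longrightarrow> e2 s \<bullet> d = 0" and s: "s \<in> I"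
  shows "k2 s * D k1 s = k1 s * D k2 s"
proof -
  have inner_deriv: "((\<lambda>t. f t \<bullet> d) has_vector_derivative f' \<bullet> d) (at t within I)"
    if "(f has_vector_derivative f') (at t within I)" for f f' t
    using bounded_linear.has_vector_derivative[OF bounded_linear_inner_left that] .
  let ?a = "\<lambda>t. e1 t \<bullet> d" and ?b = "\<lambda>t. e3 t \<bullet> d"
  have zero: "- k1 t * ?a t + k2 t * ?b t = 0" if t: "t \<in> I" for t
  proof -
    have "(\<lambda>t. e2 t \<bullet> d) constant_on I" using d(2) by (auto simp: constant_on_def)
    from deriv_along_eq[OF t constant_on_imp_zero_deriv[OF this t]]
      deriv_along_eq[OF t inner_deriv[OF deriv_e2[OF t]]]
    show ?thesis by (simp add: inner_add_left inner_diff_left)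
  qed
  have a: "(?a has_vector_derivative 0) (at s within I)"
    using inner_deriv[OF deriv_e1[OF s]] d(2)[OF s] by simp
  have b: "(?b has_vector_derivative 0) (at s within I)"
    using inner_deriv[OF deriv_e3[OF s]] d(2)[OF s] by simp
  have "(\<lambda>t. - (k1 t * ?a t) + k2 t * ?b t) constant_on I"
    using zero by (auto simp: constant_on_def)
  moreover have "((\<lambda>t. - (k1 t * ?a t) + k2 t * ?b t) has_vector_derivative
      - (D k1 s * ?a s) + D k2 s * ?b s) (at s within I)"
    using has_vector_derivative_add[OF
        has_vector_derivative_minus[OF has_vector_derivative_mult[OF deriv_k1[OF s] a]]
        has_vector_derivative_mult[OF deriv_k2[OF s] b]] by simp
  ultimately have zero': "- (D k1 s * ?a s) + D k2 s * ?b s = 0"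
    using deriv_along_eq[OF s] deriv_along_eq[OF s constant_on_imp_zero_deriv[OF _ s]] by fastforce
  have "?a s \<noteq> 0 \<or> ?b s \<noteq> 0"
  proof (rule ccontr)
    assume "\<not> ?thesis"
    then have "d = 0"
      using orthonormal_expansion[of "e1 s" "e2 s" d] unit1[OF s] unit2[OF s] orthogonal12[OF s]
        e3_eq[OF s] d(2)[OF s] by (simp add: norm_eq_1 inner_commute)
    then show False using d(1) by simp
  qed
  moreover have "?a s * (k2 s * D k1 s - k1 s * D k2 s) = 0" "?b s * (k2 s * D k1 s - k1 s * D k2 s) = 0"
    using zero[OF s] zero' by algebra+
  ultimately show ?thesis by auto
qed

text \<open>
  The hypothesis says that \<open>k\<^sub>1 / k\<^sub>2\<close> has derivative zero. If \<open>c\<close> is its constant value, the derivative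
  of \<open>e\<^sub>1 + c e\<^sub>3\<close> is \<open>(k\<^sub>1 - c k\<^sub>2) e\<^sub>2 = 0\<close>; normalising this constant vector gives the direction.
\<close>

lemma wronskian_zero_imp_fixed_normal:
  assumes "\<And>s. s \<in> I \<Longrightarrow> k2 s * D k1 s = k1 s * D k2 s"
  shows "\<exists>d. norm d = 1 \<and> (\<forall>s\<in>I. e2 s \<bullet> d = 0)"
proof -
  have "((\<lambda>s. k1 s / k2 s) has_vector_derivative 0) (at s within I)" if s: "s \<in> I" for s
    using DERIV_divide[of k1 "D k1 s" s I k2 "D k2 s"] deriv_k1[OF s] deriv_k2[OF s] k2_nonzero[OF s]
      assms[OF s]
    by (simp add: has_real_derivative_iff_has_vector_derivative mult.commute)
  from zero_deriv_imp_constant_on[OF this]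
  obtain c where c: "\<And>s. s \<in> I \<Longrightarrow> k1 s / k2 s = c"
    unfolding constant_on_def by blast
  have "((\<lambda>s. e1 s + c *\<^sub>R e3 s) has_vector_derivative 0) (at s within I)" if s: "s \<in> I" for s
  proof -
    have "k1 s *\<^sub>R e2 s + c *\<^sub>R (- k2 s *\<^sub>R e2 s) = 0"
      using c[OF s] k2_nonzero[OF s] by auto
    moreover have "((\<lambda>s. e1 s + c *\<^sub>R e3 s) has_vector_derivative
        k1 s *\<^sub>R e2 s + c *\<^sub>R (- k2 s *\<^sub>R e2 s)) (at s within I)"
      by (intro has_vector_derivative_add deriv_e1[OF s] deriv_e3[OF s]
          bounded_linear.has_vector_derivative[OF bounded_linear_scaleR_right])
    ultimately show ?thesis by metis
  qed
  from zero_deriv_imp_constant_on[OF this]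
  obtain d where d: "\<And>s. s \<in> I \<Longrightarrow> e1 s + c *\<^sub>R e3 s = d"
    unfolding constant_on_def by blast
  obtain s0 where s0: "s0 \<in> I" using interior_nonempty interior_subset by blast
  have "e1 s0 \<bullet> d = 1"
    using d[OF s0] unit1[OF s0]
    by (simp flip: d[OF s0] add: inner_add_right norm_eq_1 e3_eq[OF s0] dot_cross_self)
  then have "d \<noteq> 0" by auto
  moreover have "e2 s \<bullet> d = 0" if s: "s \<in> I" for s
    by (simp flip: d[OF s] add: inner_add_right e3_eq[OF s] dot_cross_self inner_commute
        orthogonal12[OF s])
  ultimately show ?thesis by (intro exI[of _ "sgn d"]) (simp add: norm_sgn sgn_div_norm)
qed

text \<open>
  Lancret's condition that \<open>k\<^sub>1 / k\<^sub>2\<close> be constant is stated pointwise, as the vanishing of the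
  numerator of the derivative, since this is the factor that appears in the differential equation.
\<close>

theorem lancret: "helix I e1 \<longleftrightarrow> (\<forall>s\<in>I. k2 s * D k1 s = k1 s * D k2 s)"
  using helix_e1_iff fixed_normal_imp_wronskian_zero wronskian_zero_imp_fixed_normal by metis

lemma D_e3: "s \<in> I \<Longrightarrow> D e3 s = - k2 s *\<^sub>R e2 s"
  using deriv_along_eq deriv_e3 by blast

lemma D2_e3:
  assumes s: "s \<in> I"
  shows "(D ^^ 2) e3 s = (k1 s * k2 s) *\<^sub>R e1 s - D k2 s *\<^sub>R e2 s - (k2 s)\<^sup>2 *\<^sub>R e3 s"
proof -
  have "(D ^^ 2) e3 s = D (\<lambda>t. - k2 t *\<^sub>R e2 t) s"
    using deriv_along_cong[OF s D_e3] by (simp add: numeral_2_eq_2)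
  also have "\<dots> = - k2 s *\<^sub>R (- k1 s *\<^sub>R e1 s + k2 s *\<^sub>R e3 s) + (- D k2 s) *\<^sub>R e2 s"
    by (intro deriv_along_eq[OF s] bounded_bilinear.has_vector_derivative[OF bounded_bilinear_scaleR]
        has_vector_derivative_minus deriv_k2[OF s] deriv_e2[OF s])
  finally show ?thesis by (simp add: algebra_simps power2_eq_square)
qed

lemma deriv_k1_k2:
  "s \<in> I \<Longrightarrow> ((\<lambda>t. k1 t * k2 t) has_vector_derivative k1 s * D k2 s + D k1 s * k2 s) (at s within I)"
  using has_vector_derivative_mult[OF deriv_k1 deriv_k2] .

lemma D3_e3:
  assumes s: "s \<in> I"
  shows "(D ^^ 3) e3 s = (2 * k1 s * D k2 s + D k1 s * k2 s) *\<^sub>R e1 s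
    + ((k1 s)\<^sup>2 * k2 s - D (D k2) s + k2 s ^ 3) *\<^sub>R e2 s - (3 * k2 s * D k2 s) *\<^sub>R e3 s"
proof -
  note scale = bounded_bilinear.has_vector_derivative[OF bounded_bilinear_scaleR]
  have "(D ^^ 3) e3 s
      = D (\<lambda>t. (k1 t * k2 t) *\<^sub>R e1 t - D k2 t *\<^sub>R e2 t - (k2 t * k2 t) *\<^sub>R e3 t) s"
    using deriv_along_cong[OF s D2_e3] by (simp add: numeral_3_eq_3 numeral_2_eq_2 power2_eq_square)
  also have "\<dots> = ((k1 s * k2 s) *\<^sub>R (k1 s *\<^sub>R e2 s) + (k1 s * D k2 s + D k1 s * k2 s) *\<^sub>R e1 s)
      - (D k2 s *\<^sub>R (- k1 s *\<^sub>R e1 s + k2 s *\<^sub>R e3 s) + D (D k2) s *\<^sub>R e2 s)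
      - ((k2 s * k2 s) *\<^sub>R (- k2 s *\<^sub>R e2 s) + (k2 s * D k2 s + D k2 s * k2 s) *\<^sub>R e3 s)"
    by (intro deriv_along_eq[OF s] has_vector_derivative_diff scale deriv_k1_k2[OF s] deriv_e1[OF s]
        deriv_e2[OF s] deriv_e3[OF s] deriv_D_k2[OF s] has_vector_derivative_mult deriv_k2[OF s])
  also have "\<dots> = (k1 s * D k2 s + D k1 s * k2 s + D k2 s * k1 s) *\<^sub>R e1 s
      + (k1 s * k2 s * k1 s - D (D k2) s + k2 s * k2 s * k2 s) *\<^sub>R e2 s
      - (D k2 s * k2 s + (k2 s * D k2 s + D k2 s * k2 s)) *\<^sub>R e3 s"
    by (simp only: scaleR_add_left scaleR_diff_left scaleR_minus_left scaleR_add_right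
        scaleR_minus_right scaleR_scaleR minus_add_distrib) (simp add: mult.assoc)
  also have "\<dots> = (2 * k1 s * D k2 s + D k1 s * k2 s) *\<^sub>R e1 s
      + ((k1 s)\<^sup>2 * k2 s - D (D k2) s + k2 s ^ 3) *\<^sub>R e2 s - (3 * k2 s * D k2 s) *\<^sub>R e3 s"
  proof -
    have "k1 s * D k2 s + D k1 s * k2 s + D k2 s * k1 s = 2 * k1 s * D k2 s + D k1 s * k2 s"
      "k1 s * k2 s * k1 s - D (D k2) s + k2 s * k2 s * k2 s = (k1 s)\<^sup>2 * k2 s - D (D k2) s + k2 s ^ 3"
      "D k2 s * k2 s + (k2 s * D k2 s + D k2 s * k2 s) = 3 * k2 s * D k2 s"
      by (simp_all add: power2_eq_square power3_eq_cube)
    then show ?thesis by (simp only:)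
  qed
  finally show ?thesis .
qed

lemma D_scaled_radius_deriv:
  assumes s: "s \<in> I"
  shows "k1 s * k2 s * D (\<lambda>t. 1 / k1 t * D (\<lambda>x. 1 / k2 x) t) s
    = - D (D k2) s / k2 s + D k2 s * (D k1 s / k1 s + 2 * D k2 s / k2 s) / k2 s"
proof -
  have inner: "1 / k1 t * D (\<lambda>x. 1 / k2 x) t = - D k2 t / (k1 t * (k2 t * k2 t))" if t: "t \<in> I" for t
  proof -
    have "((\<lambda>x. 1 / k2 x) has_vector_derivative - D k2 t / (k2 t * k2 t)) (at t within I)"
      using DERIV_inverse_fun[of k2 "D k2 t" t I] deriv_k2[OF t] k2_nonzero[OF t]
      by (simp add: has_real_derivative_iff_has_vector_derivative inverse_eq_divide)
    then show ?thesis using deriv_along_eq[OF t] by fastforce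
  qed
  let ?N = "- (D (D k2) s) * (k1 s * (k2 s * k2 s))
    - (- D k2 s) * (k1 s * (k2 s * D k2 s + D k2 s * k2 s) + D k1 s * (k2 s * k2 s))"
  have q: "((\<lambda>t. k1 t * (k2 t * k2 t)) has_real_derivative
      k1 s * (k2 s * D k2 s + D k2 s * k2 s) + D k1 s * (k2 s * k2 s)) (at s within I)"
    unfolding has_real_derivative_iff_has_vector_derivative
    by (intro has_vector_derivative_mult deriv_k1[OF s] deriv_k2[OF s])
  have p: "((\<lambda>t. - D k2 t) has_real_derivative - D (D k2) s) (at s within I)"
    unfolding has_real_derivative_iff_has_vector_derivative
    by (intro has_vector_derivative_minus deriv_D_k2[OF s])
  have "D (\<lambda>t. 1 / k1 t * D (\<lambda>x. 1 / k2 x) t) s = D (\<lambda>t. - D k2 t / (k1 t * (k2 t * k2 t))) s"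
    using deriv_along_cong[OF s inner] .
  also have "\<dots> = ?N / (k1 s * (k2 s * k2 s) * (k1 s * (k2 s * k2 s)))"
    by (rule deriv_along_eq[OF s], fold has_real_derivative_iff_has_vector_derivative,
        rule DERIV_divide[OF p q]) (use k1_nonzero[OF s] k2_nonzero[OF s] in simp)
  finally show ?thesis using k1_nonzero[OF s] k2_nonzero[OF s] by (simp add: field_simps)
qed

text \<open>
  The coefficient \<open>A\<close> of the second derivative equals \<open>k\<^sub>1' / k\<^sub>1 + 2 k\<^sub>2' / k\<^sub>2\<close>, which is what cancels the
  component along \<open>e\<^sub>1\<close>; the coefficient of the first derivative then cancels the component along \<open>e\<^sub>2\<close>.
  The derivative of \<open>e\<^sub>3\<close> has no component along \<open>e\<^sub>3\<close>, so nothing compensates what remains there.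
\<close>

lemma binormal_operator_eq:
  assumes s: "s \<in> I"
  shows "(D ^^ 3) e3 s
      - (D (\<lambda>t. k1 t * k2 t) s / (k1 s * k2 s) + D k2 s / k2 s) *\<^sub>R (D ^^ 2) e3 s
      + (k1 s * k2 s * D (\<lambda>t. 1 / k1 t * D (\<lambda>x. 1 / k2 x) t) s + (k1 s)\<^sup>2 + (k2 s)\<^sup>2) *\<^sub>R D e3 s
    = (k2 s / k1 s * (k2 s * D k1 s - k1 s * D k2 s)) *\<^sub>R e3 s"
proof -
  define A where "A = D k1 s / k1 s + 2 * D k2 s / k2 s"
  note nz = k1_nonzero[OF s] k2_nonzero[OF s]
  have A: "D (\<lambda>t. k1 t * k2 t) s / (k1 s * k2 s) + D k2 s / k2 s = A"
    using nz by (simp add: A_def deriv_along_eq[OF s deriv_k1_k2[OF s]] field_simps)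
  have B: "k1 s * k2 s * D (\<lambda>t. 1 / k1 t * D (\<lambda>x. 1 / k2 x) t) s
      = (- D (D k2) s + D k2 s * A) / k2 s"
    unfolding D_scaled_radius_deriv[OF s] A_def by (simp add: add_divide_distrib diff_divide_distrib)
  \<comment> \<open>Stated for arbitrary scalars, so that collecting components does not disturb the coefficients.\<close>
  have combine: "(x1 *\<^sub>R e1 s + x2 *\<^sub>R e2 s - x3 *\<^sub>R e3 s)
      - a *\<^sub>R (y1 *\<^sub>R e1 s - y2 *\<^sub>R e2 s - y3 *\<^sub>R e3 s) + b *\<^sub>R (- z *\<^sub>R e2 s)
      = (x1 - a * y1) *\<^sub>R e1 s + (x2 + a * y2 - b * z) *\<^sub>R e2 s + (a * y3 - x3) *\<^sub>R e3 s"
    for x1 x2 x3 a b y1 y2 y3 z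
    by (simp add: algebra_simps)
  have c1: "2 * k1 s * D k2 s + D k1 s * k2 s - A * (k1 s * k2 s) = 0"
    using nz by (simp add: A_def field_simps)
  have c2: "(k1 s)\<^sup>2 * k2 s - D (D k2) s + k2 s ^ 3 + A * D k2 s
      - ((- D (D k2) s + D k2 s * A) / k2 s + (k1 s)\<^sup>2 + (k2 s)\<^sup>2) * k2 s = 0"
    using nz by (simp add: field_simps power2_eq_square power3_eq_cube)
  have c3: "A * (k2 s)\<^sup>2 - 3 * k2 s * D k2 s = k2 s / k1 s * (k2 s * D k1 s - k1 s * D k2 s)"
    using nz by (simp add: A_def field_simps power2_eq_square)
  show ?thesis
    unfolding A B D_e3[OF s] D2_e3[OF s] D3_e3[OF s] combine c1 c2 c3 by simp
qed

end

section \<open>Helices in a Myller configuration\<close>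

text \<open>
  What the moving equations leave to be shown is the smoothness of the frame and the curvatures. Since the norm and
  the quotient are smooth only away from zero, positivity of the first curvature enters here.
\<close>

lemma myller_frenet_frame:
  assumes M: "myller_configuration I r \<xi> \<pi>"
    and K1: "\<forall>s\<in>I. curvature1 I \<xi> s > 0" and K2: "\<forall>s\<in>I. curvature2 I \<xi> s \<noteq> 0"
  shows "frenet_frame I \<xi> (frame2 I \<xi>) (frame3 I \<xi>) (curvature1 I \<xi>) (curvature2 I \<xi>)"
proof -
  interpret parameter_interval I
    using M by unfold_locales (auto simp: myller_configuration_def)
  have sm: "smooth_along I \<xi>" using M by (simp add: myller_configuration_def versor_field_def)
  note smD = smooth_along_deriv[OF sm]
  have nz: "D \<xi> s \<noteq> 0" if "s \<in> I" for s using K1 that by (force simp: curvature1_def)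
  have sm1: "smooth_along I (curvature1 I \<xi>)"
    using smD nz by (simp add: curvature1_def smooth_along_iff_order differentiable_order_norm)
  have sm2: "smooth_along I (frame2 I \<xi>)"
    unfolding frame2_def curvature1_def divide_inverse mult_1
    by (intro smooth_along_bilinear[OF bounded_bilinear_scaleR] smooth_along_inverse_norm smD nz)
  have "bounded_bilinear cross3" using bilinear_cross bilinear_conv_bounded_bilinear by blast
  then have sm3: "smooth_along I (frame3 I \<xi>)"
    unfolding frame3_def using sm sm2 by (rule smooth_along_bilinear)
  have smk2: "smooth_along I (curvature2 I \<xi>)"
    unfolding curvature2_def
    by (intro smooth_along_bilinear[OF bounded_bilinear_inner] smooth_along_deriv sm2 sm3)
  note eqs = frenet_type_equations[OF M K1]
  note hd = has_deriv_along[OF smooth_along_differentiable]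
  show ?thesis
    by unfold_locales
      (use K1 K2 sm1 smk2 eqs hd[OF sm] hd[OF sm2] hd[OF sm3] in \<open>force simp: frame3_def\<close>)+
qed

theorem corollary24:
  fixes I :: "real set" and r \<xi> :: "real \<Rightarrow> real^3" and \<pi> :: "real \<Rightarrow> (real^3) set"
    and \<xi>\<^sub>1 \<xi>\<^sub>3 :: "real \<Rightarrow> real^3" and K\<^sub>1 K\<^sub>2 :: "real \<Rightarrow> real"
  defines "\<xi>\<^sub>1 \<equiv> \<xi>" and "\<xi>\<^sub>3 \<equiv> frame3 I \<xi>"
    and "K\<^sub>1 \<equiv> curvature1 I \<xi>" and "K\<^sub>2 \<equiv> curvature2 I \<xi>"
  assumes "myller_configuration I r \<xi> \<pi>"
    and "\<forall>s\<in>I. K\<^sub>1 s > 0" and "\<forall>s\<in>I. K\<^sub>2 s \<noteq> 0"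
  shows "(helix I \<xi>\<^sub>1 \<longleftrightarrow> helix I \<xi>\<^sub>3) \<and>
    (helix I \<xi>\<^sub>1 \<longleftrightarrow>
      (\<forall>s\<in>I.
        (deriv_along I ^^ 3) \<xi>\<^sub>3 s
        - (deriv_along I (\<lambda>t. K\<^sub>1 t * K\<^sub>2 t) s / (K\<^sub>1 s * K\<^sub>2 s)
            + deriv_along I K\<^sub>2 s / K\<^sub>2 s)
            *\<^sub>R (deriv_along I ^^ 2) \<xi>\<^sub>3 s
        + (K\<^sub>1 s * K\<^sub>2 s * deriv_along I (\<lambda>t. 1 / K\<^sub>1 t * deriv_along I (\<lambda>x. 1 / K\<^sub>2 x) t) s
            + (K\<^sub>1 s)\<^sup>2 + (K\<^sub>2 s)\<^sup>2)
            *\<^sub>R deriv_along I \<xi>\<^sub>3 s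
        = 0))"
proof -
  interpret frenet_frame I \<xi>\<^sub>1 "frame2 I \<xi>" \<xi>\<^sub>3 K\<^sub>1 K\<^sub>2
    using assms myller_frenet_frame by simp
  have "(K\<^sub>2 s / K\<^sub>1 s * (K\<^sub>2 s * D K\<^sub>1 s - K\<^sub>1 s * D K\<^sub>2 s)) *\<^sub>R \<xi>\<^sub>3 s = 0
      \<longleftrightarrow> K\<^sub>2 s * D K\<^sub>1 s = K\<^sub>1 s * D K\<^sub>2 s" if "s \<in> I" for s
    using unit3[OF that] k1_nonzero[OF that] k2_nonzero[OF that] by force
  then show ?thesis
    using helix_e1_iff helix_e3_iff lancret binormal_operator_eq by simp
qed

end
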